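(* Let $p\in[2,\infty]$, $\varepsilon\in[0,1]$, $D>0$, $B>0$. There exist absolute constants $c_0,c_1>0$ (one can take $c_0=\frac{1}{2e(e-1)^2}$ and $c_1=\frac{1}{36(e-1)\sqrt{2e}}$) such that, for all $T\ge c_0\frac{d^2}{\varepsilon^2}$, \[ \sup_{\mathcal{X}\in\mathbb{X}_p(D)}\mathcal{E}^*(\mathcal{X},\mathcal{O}_{\mathtt{c},p},T,\mathcal{W}_{\mathtt{priv},\varepsilon})\ \ge\ \frac{c_1DB\,d^{1/2-1/p}}{\sqrt T}\cdot\sqrt{\frac{d}{\varepsilon^2}}. \]
   Context: Setting (first-order optimization under information constraints). Fix $d\ge1$, $\mathcal{X}\subseteq\mathbb{R}^d$, and a set $\mathcal{W}$ of channels (randomized maps/Markov kernels) with input space $\mathbb{R}^d$. An algorithm $\pi$ with $T$ queries interacts with an oracle $O$ for a function $f:\mathcal{X}\to\mathbb{R}$: at step $t=1,\dots,T$ it queries $x_t\in\mathcal{X}$; the oracle returns a random vector $\hat g(x_t)$ with $\mathbb{E}[\hat g(x_t)\mid x_t]\in\partial f(x_t)$; $\hat g(x_t)$ is passed through a channel $W_t\in\mathcal{W}$ and the algorithm only observes the output $Y_t\sim W_t(\cdot\mid\hat g(x_t))$; $x_{t+1}$ (and the final output $x_T$) is a possibly randomized function of $Y_1,\dots,Y_t$. An adaptive channel selection strategy chooses each $W_t$ as a function of $Y_1,\dots,Y_{t-1}$. For a class $\mathcal{O}$ of function–oracle pairs, $\mathcal{E}^*(\mathcal{X},\mathcal{O},T,\mathcal{W})=\inf_{\pi}\inf_{S\text{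 adaptive}}\sup_{(f,O)\in\mathcal{O}}\mathbb{E}[f(x_T)-\min_{x\in\mathcal{X}}f(x)]$. For $p\in[1,\infty]$ let $q=p/(p-1)$; $\mathcal{O}_{\mathtt{c},p}$ is the set of pairs $(f,O)$ with $f$ convex on $\mathcal{X}$ and oracle outputs satisfying $\mathbb{E}[\hat g(x)\mid x]\in\partial f(x)$ and $\Pr(\|\hat g(x)\|_q^2\le B^2\mid x)=1$ for all $x\in\mathcal{X}$. $\mathbb{X}_p(D)=\{\mathcal{X}\subseteq\mathbb{R}^d:\max_{x,y\in\mathcal{X}}\|x-y\|_p\le D\}$. $\mathcal{W}_{\mathtt{priv},\varepsilon}$ is the set of all channels $W:\mathbb{R}^d\to\mathbb{R}^d$ with $W(Y\in S\mid X=x)\le e^{\varepsilon}W(Y\in S\mid X=x')$ for all $x,x'$ and Borel $S$. *)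

theory Defs
  imports "HOL-Analysis.Analysis" "HOL-Probability.Probability"
begin

definition lpnorm :: "ereal \<Rightarrow> real^'n \<Rightarrow> real" where
  "lpnorm p x = (if p = \<infinity> then Max (range (\<lambda>i. \<bar>x $ i\<bar>))
                 else (\<Sum>i\<in>UNIV. \<bar>x $ i\<bar> powr real_of_ereal p) powr (1 / real_of_ereal p))"

definition conj_exp :: "ereal \<Rightarrow> ereal" where
  "conj_exp p = (if p = \<infinity> then 1 else if p = 1 then \<infinity>
                 else ereal (real_of_ereal p / (real_of_ereal p - 1)))"

definition inv_exp :: "ereal \<Rightarrow> real" where
  "inv_exp p = (if p = \<infinity> then 0 else 1 / real_of_ereal p)"

definition Xset :: "ereal \<Rightarrow> real \<Rightarrow> (real^'n) set set" where
  "Xset p D = {X. X \<noteq> {} \<and> (\<forall>x\<in>X. \<forall>y\<in>X. lpnorm p (x - y) \<le> D)}"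

definition subdiff :: "(real^'n \<Rightarrow> real) \<Rightarrow> (real^'n) set \<Rightarrow> real^'n \<Rightarrow> (real^'n) set" where
  "subdiff f X x = {g. \<forall>y\<in>X. f y \<ge> f x + inner g (y - x)}"

definition channel :: "(real^'n \<Rightarrow> (real^'n) measure) \<Rightarrow> bool" where
  "channel W \<longleftrightarrow> W \<in> borel \<rightarrow>\<^sub>M prob_algebra borel"

definition priv_channel :: "real \<Rightarrow> (real^'n \<Rightarrow> (real^'n) measure) \<Rightarrow> bool" where
  "priv_channel \<epsilon> W \<longleftrightarrow> channel W \<and>
     (\<forall>x x' S. S \<in> sets borel \<longrightarrow> emeasure (W x) S \<le> ennreal (exp \<epsilon>) * emeasure (W x') S)"

definition oracle_pair :: "ereal \<Rightarrow> real \<Rightarrow> (real^'n) set \<Rightarrow> (real^'n \<Rightarrow> real)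
    \<Rightarrow> (real^'n \<Rightarrow> (real^'n) measure) \<Rightarrow> bool" where
  "oracle_pair p B X f Orc \<longleftrightarrow> convex_on X f \<and>
     Orc \<in> borel \<rightarrow>\<^sub>M prob_algebra borel \<and>
     (\<forall>x\<in>X. (AE g in Orc x. (lpnorm (conj_exp p) g)\<^sup>2 \<le> B\<^sup>2) \<and>
              (\<integral>g. g \<partial>Orc x) \<in> subdiff f X x)"

text \<open>Histories of observations: h :: nat => R^d, where h i is Y_{i+1}; entries not yet
  observed are 0.  The algorithm uses an internal random seed u ~ mu (on the reals, which
  encodes arbitrary internal randomness), query t u h is the (t+1)-th query point and
  outp u h the final output, both measurable functions of the seed and the observations.\<close>

abbreviation hist_space :: "(nat \<Rightarrow> real^'n) measure" where
  "hist_space \<equiv> Pi\<^sub>M UNIV (\<lambda>_. borel)"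

definition algorithm :: "(real^'n) set \<Rightarrow> real measure
    \<Rightarrow> (nat \<Rightarrow> real \<Rightarrow> (nat \<Rightarrow> real^'n) \<Rightarrow> real^'n)
    \<Rightarrow> (real \<Rightarrow> (nat \<Rightarrow> real^'n) \<Rightarrow> real^'n) \<Rightarrow> bool" where
  "algorithm X \<mu> query outp \<longleftrightarrow> prob_space \<mu> \<and> sets \<mu> = sets borel \<and>
     (\<forall>t. (\<lambda>uh. query t (fst uh) (snd uh)) \<in> (borel \<Otimes>\<^sub>M hist_space) \<rightarrow>\<^sub>M borel) \<and>
     (\<lambda>uh. outp (fst uh) (snd uh)) \<in> (borel \<Otimes>\<^sub>M hist_space) \<rightarrow>\<^sub>M borel \<and>
     (\<forall>t u h. query t u h \<in> X) \<and> (\<forall>u h. outp u h \<in> X)"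

text \<open>Adaptive channel selection: W_{t+1} = S t h depends on Y_1..Y_t only.\<close>
definition strategy :: "real \<Rightarrow> (nat \<Rightarrow> (nat \<Rightarrow> real^'n) \<Rightarrow> real^'n \<Rightarrow> (real^'n) measure) \<Rightarrow> bool" where
  "strategy \<epsilon> S \<longleftrightarrow>
     (\<forall>t. (\<lambda>hg. S t (fst hg) (snd hg)) \<in> (hist_space \<Otimes>\<^sub>M borel) \<rightarrow>\<^sub>M prob_algebra borel) \<and>
     (\<forall>t h. priv_channel \<epsilon> (S t h))"

fun process :: "real measure \<Rightarrow> (nat \<Rightarrow> real \<Rightarrow> (nat \<Rightarrow> real^'n) \<Rightarrow> real^'n)
    \<Rightarrow> (nat \<Rightarrow> (nat \<Rightarrow> real^'n) \<Rightarrow> real^'n \<Rightarrow> (real^'n) measure)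
    \<Rightarrow> (real^'n \<Rightarrow> (real^'n) measure) \<Rightarrow> nat \<Rightarrow> (real \<times> (nat \<Rightarrow> real^'n)) measure" where
  "process \<mu> query S Orc 0 = distr \<mu> (borel \<Otimes>\<^sub>M hist_space) (\<lambda>u. (u, \<lambda>_. 0))"
| "process \<mu> query S Orc (Suc t) =
     Giry_Monad.bind (process \<mu> query S Orc t) (\<lambda>uh.
       distr (Giry_Monad.bind (Orc (query t (fst uh) (snd uh))) (S t (snd uh)))
             (borel \<Otimes>\<^sub>M hist_space) (\<lambda>y. (fst uh, (snd uh)(t := y))))"

definition opt_error :: "(real^'n) set \<Rightarrow> (real^'n \<Rightarrow> real) \<Rightarrow> (real^'n \<Rightarrow> (real^'n) measure)
    \<Rightarrow> real measure \<Rightarrow> (nat \<Rightarrow> real \<Rightarrow> (nat \<Rightarrow> real^'n) \<Rightarrow> real^'n)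
    \<Rightarrow> (real \<Rightarrow> (nat \<Rightarrow> real^'n) \<Rightarrow> real^'n)
    \<Rightarrow> (nat \<Rightarrow> (nat \<Rightarrow> real^'n) \<Rightarrow> real^'n \<Rightarrow> (real^'n) measure) \<Rightarrow> nat \<Rightarrow> ennreal" where
  "opt_error X f Orc \<mu> query outp S T =
     (\<integral>\<^sup>+ uh. ennreal (f (outp (fst uh) (snd uh)) - Inf (f ` X)) \<partial>process \<mu> query S Orc T)"

definition minimax_error :: "(real^'n) set \<Rightarrow> ereal \<Rightarrow> real \<Rightarrow> nat \<Rightarrow> real \<Rightarrow> ennreal" where
  "minimax_error X p B T \<epsilon> =
     (INF alg \<in> {(\<mu>, query, outp). algorithm X \<mu> query outp}.
        INF S \<in> {S. strategy \<epsilon> S}.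
          SUP fO \<in> {(f, Orc). oracle_pair p B X f Orc}.
            opt_error X (fst fO) (snd fO) (fst alg) (fst (snd alg)) (snd (snd alg)) S T)"

end

theory Submission
  imports Defs
begin

text \<open>The oracle returns \<open>\<plusminus>B e\<^sub>i\<close> for a uniformly random coordinate \<open>i\<close>, with sign bias
  \<open>\<delta> v\<^sub>i\<close>, whatever the query. This is an oracle for the linear function whose slope has coordinates
  \<open>B \<delta> v\<^sub>i / d\<close>, so a point of a centred cube pays for every coordinate whose sign it gets wrong.
  Flipping one bit of \<open>v\<close> moves only mass \<open>\<delta> / d\<close>, and only between two inputs of the
  channel; by privacy the law of one observation then changes by \<open>O(\<epsilon> \<delta> / d)\<close> in relative terms,
  hence by the square of this in chi-square divergence. With \<open>\<delta>\<close> of order \<open>d / (\<epsilon> sqrt T)\<close> the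
  total divergence over \<open>T\<close> rounds stays bounded, and Assouad's argument shows that a constant
  fraction of the bits cannot be recovered.\<close>

subsection \<open>Chi-square bounds in dual form\<close>

text \<open>The dual form of \<open>1 + \<chi>\<^sup>2(P, Q) \<le> \<alpha>\<close>: it tensorises along kernels without any
  reference to densities.\<close>

definition chi2_bounded :: "real \<Rightarrow> 'a measure \<Rightarrow> 'a measure \<Rightarrow> bool" where
  "chi2_bounded \<alpha> P Q \<longleftrightarrow> (\<forall>\<phi>\<in>borel_measurable Q. (\<forall>x\<in>space Q. 0 \<le> \<phi> x \<and> \<phi> x \<le> 1) \<longrightarrow>
     (\<integral>x. \<phi> x \<partial>P)\<^sup>2 \<le> \<alpha> * (\<integral>x. (\<phi> x)\<^sup>2 \<partial>Q))"

lemma chi2_boundedD: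
  assumes "chi2_bounded \<alpha> P Q" "\<phi> \<in> borel_measurable Q" "\<forall>x\<in>space Q. 0 \<le> \<phi> x \<and> \<phi> x \<le> 1"
  shows "(\<integral>x. \<phi> x \<partial>P)\<^sup>2 \<le> \<alpha> * (\<integral>x. (\<phi> x)\<^sup>2 \<partial>Q)"
  using assms unfolding chi2_bounded_def by (elim ballE[of _ _ \<phi>]) simp_all

lemma borel_measurable_cong_sets:
  "sets M = sets N \<Longrightarrow> f \<in> borel_measurable N \<Longrightarrow> f \<in> borel_measurable M"
  using measurable_cong_sets by blast

lemma prob_integrable_bounded:
  fixes f :: "'a \<Rightarrow> real"
  assumes "prob_space M" "f \<in> borel_measurable M" "\<And>x. x \<in> space M \<Longrightarrow> \<bar>f x\<bar> \<le> c"
  shows "integrable M f"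
proof -
  interpret prob_space M by fact
  show ?thesis by (rule integrable_const_bound[where B=c]) (use assms in auto)
qed

lemma prob_integral_unit:
  fixes f :: "'a \<Rightarrow> real"
  assumes "prob_space M" "f \<in> borel_measurable M" "\<And>x. x \<in> space M \<Longrightarrow> 0 \<le> f x \<and> f x \<le> 1"
  shows "0 \<le> integral\<^sup>L M f \<and> integral\<^sup>L M f \<le> 1"
proof -
  interpret prob_space M by fact
  have "integrable M f" by (rule prob_integrable_bounded[OF assms(1,2), of 1]) (use assms(3) in force)
  then have "integral\<^sup>L M f \<le> integral\<^sup>L M (\<lambda>_. 1)"
    by (intro integral_mono) (use assms in auto)
  then show ?thesis using assms(3) by (auto simp: prob_space intro!: integral_nonneg_AE)
qed

text \<open>Data processing: composing with \<open>f\<close> turns a test function on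
  \<open>N\<close> into one on the source, still with values between 0 and 1, so the hypothesis
  applies to the composition.\<close>

lemma chi2_bounded_distr:
  assumes "chi2_bounded \<alpha> P Q" "f \<in> Q \<rightarrow>\<^sub>M N" "sets P = sets Q"
  shows "chi2_bounded \<alpha> (distr P N f) (distr Q N f)"
  unfolding chi2_bounded_def
proof (intro ballI impI)
  have fP: "f \<in> P \<rightarrow>\<^sub>M N" using assms(2,3) by (simp cong: measurable_cong_sets)
  fix \<phi> :: "'b \<Rightarrow> real"
  assume \<phi>: "\<phi> \<in> borel_measurable (distr Q N f)" "\<forall>x\<in>space (distr Q N f). 0 \<le> \<phi> x \<and> \<phi> x \<le> 1"
  then have [measurable]: "\<phi> \<in> borel_measurable N" by simp
  have "(\<lambda>x. \<phi> (f x)) \<in> borel_measurable Q" using assms(2) by measurable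
  moreover have "\<forall>x\<in>space Q. 0 \<le> \<phi> (f x) \<and> \<phi> (f x) \<le> 1"
    using \<phi>(2) measurable_space[OF assms(2)] by auto
  ultimately have "(\<integral>x. \<phi> (f x) \<partial>P)\<^sup>2 \<le> \<alpha> * (\<integral>x. (\<phi> (f x))\<^sup>2 \<partial>Q)"
    by (rule chi2_boundedD[OF assms(1)])
  then show "(\<integral>x. \<phi> x \<partial>distr P N f)\<^sup>2 \<le> \<alpha> * (\<integral>x. (\<phi> x)\<^sup>2 \<partial>distr Q N f)"
    by (subst (1 2) integral_distr) (use fP assms(2) in auto)
qed

lemma prob_kernelD:
  assumes "K \<in> M \<rightarrow>\<^sub>M prob_algebra N" "x \<in> space M"
  shows "prob_space (K x)" "sets (K x) = sets N"
  using measurable_space[OF assms] by (auto simp: space_prob_algebra)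

lemma integral_bind_prob:
  fixes f :: "'b \<Rightarrow> real"
  assumes "P \<in> space (prob_algebra M)" "K \<in> M \<rightarrow>\<^sub>M prob_algebra N"
    and "f \<in> borel_measurable N" "\<And>x. x \<in> space N \<Longrightarrow> \<bar>f x\<bar> \<le> c"
  shows "integral\<^sup>L (P \<bind> K) f = (\<integral>x. integral\<^sup>L (K x) f \<partial>P)"
proof (rule integral_bind[where B'=1])
  have P: "sets P = sets M" "prob_space P" using assms(1) by (auto simp: space_prob_algebra)
  show "K \<in> P \<rightarrow>\<^sub>M subprob_algebra N"
    using measurable_prob_algebraD[OF assms(2)] P by (simp cong: measurable_cong_sets)
  show "finite_measure P" using P(2) by (simp add: prob_space_def)
  show "AE x in P. emeasure (K x) (space (K x)) \<le> ennreal 1"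
    using prob_kernelD(1)[OF assms(2)] sets_eq_imp_space_eq[OF P(1)]
    by (intro AE_I2) (auto simp: prob_space.emeasure_space_1)
qed (use assms in auto)

text \<open>The chain rule for the divergence. Integrating a test function along \<open>K x\<close>
  yields a test function of \<open>x\<close>, again between 0 and 1. The bound for \<open>P\<close>
  and \<open>Q\<close> applies to it first, then the kernel bound at each point; the two factors
  multiply.\<close>

lemma chi2_bounded_bind:
  assumes P: "P \<in> space (prob_algebra M)" and Q: "Q \<in> space (prob_algebra M)"
    and K[measurable]: "K \<in> M \<rightarrow>\<^sub>M prob_algebra N" and L[measurable]: "L \<in> M \<rightarrow>\<^sub>M prob_algebra N"
    and PQ: "chi2_bounded \<alpha> P Q" and "0 \<le> \<alpha>"
    and KL: "\<And>x. x \<in> space M \<Longrightarrow> chi2_bounded \<beta> (K x) (L x)"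
  shows "chi2_bounded (\<alpha> * \<beta>) (P \<bind> K) (Q \<bind> L)"
  unfolding chi2_bounded_def
proof (intro ballI impI)
  have sP: "sets P = sets M" "sets Q = sets M" "prob_space P" "prob_space Q"
    using P Q by (auto simp: space_prob_algebra)
  have sp: "space P = space M" "space Q = space M" using sP by (auto dest: sets_eq_imp_space_eq)
  have sQL: "sets (Q \<bind> L) = sets N" by (rule sets_bind'[OF Q L])
  fix \<phi> :: "'b \<Rightarrow> real"
  assume "\<phi> \<in> borel_measurable (Q \<bind> L)" "\<forall>x\<in>space (Q \<bind> L). 0 \<le> \<phi> x \<and> \<phi> x \<le> 1"
  then have \<phi>[measurable]: "\<phi> \<in> borel_measurable N" and b: "\<And>x. x \<in> space N \<Longrightarrow> 0 \<le> \<phi> x \<and> \<phi> x \<le> 1"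
    using sets_eq_imp_space_eq[OF sQL] by (auto intro: borel_measurable_cong_sets[OF sQL[symmetric]])
  have b2: "0 \<le> (\<phi> x)\<^sup>2 \<and> (\<phi> x)\<^sup>2 \<le> 1" if "x \<in> space N" for x
    using b[OF that] by (simp add: power_le_one)
  have Km: "(\<lambda>x. integral\<^sup>L (K x) \<psi>) \<in> borel_measurable M" "(\<lambda>x. integral\<^sup>L (L x) \<psi>) \<in> borel_measurable M"
    if [measurable]: "\<psi> \<in> borel_measurable N" for \<psi> :: "'b \<Rightarrow> real"
    by (intro measurable_compose[OF _ integral_measurable_subprob_algebra[OF that]]
        measurable_prob_algebraD K L)+
  have unitK: "0 \<le> integral\<^sup>L (K x) \<phi> \<and> integral\<^sup>L (K x) \<phi> \<le> 1" if "x \<in> space M" for x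
    using prob_kernelD(1)[OF K that] b sets_eq_imp_space_eq[OF prob_kernelD(2)[OF K that]]
    by (intro prob_integral_unit borel_measurable_cong_sets[OF prob_kernelD(2)[OF K that]]) auto
  have unitL: "0 \<le> integral\<^sup>L (L x) (\<lambda>y. (\<phi> y)\<^sup>2) \<and> integral\<^sup>L (L x) (\<lambda>y. (\<phi> y)\<^sup>2) \<le> 1" if "x \<in> space M" for x
    using prob_kernelD(1)[OF L that] b2 sets_eq_imp_space_eq[OF prob_kernelD(2)[OF L that]]
    by (intro prob_integral_unit borel_measurable_cong_sets[OF prob_kernelD(2)[OF L that]]) auto
  have "(\<integral>x. \<phi> x \<partial>(P \<bind> K))\<^sup>2 = (\<integral>x. integral\<^sup>L (K x) \<phi> \<partial>P)\<^sup>2"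
    using b by (subst integral_bind_prob[OF P K \<phi>, of 1]) force+
  also have "\<dots> \<le> \<alpha> * (\<integral>x. (integral\<^sup>L (K x) \<phi>)\<^sup>2 \<partial>Q)"
  proof -
    have "(\<lambda>x. integral\<^sup>L (K x) \<phi>) \<in> borel_measurable Q"
      by (rule borel_measurable_cong_sets[OF sP(2) Km(1)[OF \<phi>]])
    moreover have "\<forall>x\<in>space Q. 0 \<le> integral\<^sup>L (K x) \<phi> \<and> integral\<^sup>L (K x) \<phi> \<le> 1"
      using unitK sp by simp
    ultimately show ?thesis by (rule chi2_boundedD[OF PQ])
  qed
  finally have PK: "(\<integral>x. \<phi> x \<partial>(P \<bind> K))\<^sup>2 \<le> \<alpha> * (\<integral>x. (integral\<^sup>L (K x) \<phi>)\<^sup>2 \<partial>Q)" .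
  \<comment> \<open>The squared inner integral left over from the first bound is exactly the
    left-hand side of the kernel bound at \<open>x\<close>.\<close>
  have "(\<integral>x. (integral\<^sup>L (K x) \<phi>)\<^sup>2 \<partial>Q) \<le> (\<integral>x. \<beta> * integral\<^sup>L (L x) (\<lambda>y. (\<phi> y)\<^sup>2) \<partial>Q)"
  proof (rule integral_mono)
    show "integrable Q (\<lambda>x. (integral\<^sup>L (K x) \<phi>)\<^sup>2)"
      by (rule prob_integrable_bounded[OF sP(4), of _ 1])
        (use Km(1)[OF \<phi>] unitK sp in \<open>auto intro!: borel_measurable_cong_sets[OF sP(2)] simp: power_le_one\<close>)
    show "integrable Q (\<lambda>x. \<beta> * integral\<^sup>L (L x) (\<lambda>y. (\<phi> y)\<^sup>2))"
      by (rule integrable_mult_right, rule prob_integrable_bounded[OF sP(4), of _ 1])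
        (use Km(2)[of "\<lambda>y. (\<phi> y)\<^sup>2"] unitL sp in \<open>auto intro!: borel_measurable_cong_sets[OF sP(2)]\<close>)
    fix x assume x: "x \<in> space Q"
    show "(integral\<^sup>L (K x) \<phi>)\<^sup>2 \<le> \<beta> * integral\<^sup>L (L x) (\<lambda>y. (\<phi> y)\<^sup>2)"
    proof -
      have xM: "x \<in> space M" using x sp by simp
      have sL: "sets (L x) = sets N" by (rule prob_kernelD(2)[OF L xM])
      have "\<phi> \<in> borel_measurable (L x)" by (rule borel_measurable_cong_sets[OF sL \<phi>])
      moreover have "\<forall>y\<in>space (L x). 0 \<le> \<phi> y \<and> \<phi> y \<le> 1"
        using b sets_eq_imp_space_eq[OF sL] by simp
      ultimately show ?thesis by (rule chi2_boundedD[OF KL[OF xM]])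
    qed
  qed
  also have "\<dots> = \<beta> * (\<integral>x. (\<phi> x)\<^sup>2 \<partial>(Q \<bind> L))"
    using b2 by (subst integral_bind_prob[OF Q L, of "\<lambda>x. (\<phi> x)\<^sup>2" 1]) auto
  finally have "\<alpha> * (\<integral>x. (integral\<^sup>L (K x) \<phi>)\<^sup>2 \<partial>Q) \<le> \<alpha> * (\<beta> * (\<integral>x. (\<phi> x)\<^sup>2 \<partial>(Q \<bind> L)))"
    by (rule mult_left_mono[OF _ \<open>0 \<le> \<alpha>\<close>])
  with PK show "(\<integral>x. \<phi> x \<partial>(P \<bind> K))\<^sup>2 \<le> \<alpha> * \<beta> * (\<integral>x. (\<phi> x)\<^sup>2 \<partial>(Q \<bind> L))"
    by (simp add: mult.assoc)
qed

text \<open>This is nonnegativity of the variance.\<close>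

lemma chi2_bounded_refl:
  assumes "prob_space P" shows "chi2_bounded 1 P P"
  unfolding chi2_bounded_def
proof (intro ballI impI)
  interpret prob_space P by fact
  fix f :: "'a \<Rightarrow> real" assume f: "f \<in> borel_measurable P" "\<forall>x\<in>space P. 0 \<le> f x \<and> f x \<le> 1"
  have "integrable P f" "integrable P (\<lambda>x. (f x)\<^sup>2)"
    using f by (auto intro!: prob_integrable_bounded[OF assms, of _ 1] simp: power_le_one)
  then show "(\<integral>x. f x \<partial>P)\<^sup>2 \<le> 1 * (\<integral>x. (f x)\<^sup>2 \<partial>P)"
    using variance_positive[of f] variance_eq[of f] by simp
qed

lemma chi2_bounded_mono:
  assumes "chi2_bounded \<alpha> P Q" "\<alpha> \<le> \<beta>"
  shows "chi2_bounded \<beta> P Q"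
  unfolding chi2_bounded_def
proof (intro ballI impI)
  fix f :: "'a \<Rightarrow> real" assume f: "f \<in> borel_measurable Q" "\<forall>x\<in>space Q. 0 \<le> f x \<and> f x \<le> 1"
  have "0 \<le> (\<integral>x. (f x)\<^sup>2 \<partial>Q)" by simp
  then show "(\<integral>x. f x \<partial>P)\<^sup>2 \<le> \<beta> * (\<integral>x. (f x)\<^sup>2 \<partial>Q)"
    using chi2_boundedD[OF assms(1) f] mult_right_mono[OF assms(2), of "\<integral>x. (f x)\<^sup>2 \<partial>Q"] by linarith
qed

text \<open>Le Cam's two-point bound. With a the \<open>P\<close>-mass of \<open>A\<close> and b the
  \<open>Q\<close>-mass of its complement, testing with the indicator of that complement gives (1 -
  a)^2 \<le> 2 b, hence a + b \<ge> (1 + a^2) / 2.\<close>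

lemma chi2_bounded_testing:
  assumes "prob_space P" "prob_space Q" "sets P = sets Q" "chi2_bounded 2 P Q" "A \<in> sets Q"
  shows "1/2 \<le> measure P A + measure Q (space Q - A)"
proof -
  interpret P: prob_space P by fact
  interpret Q: prob_space Q by fact
  have sp: "space P = space Q" using assms(3) by (rule sets_eq_imp_space_eq)
  let ?B = "space Q - A"
  have B: "?B \<in> sets Q" "?B \<in> sets P" using assms by auto
  have "(\<integral>x. indicator ?B x \<partial>P)\<^sup>2 \<le> 2 * (\<integral>x. (indicator ?B x :: real)\<^sup>2 \<partial>Q)"
    using B by (intro chi2_boundedD[OF assms(4)]) (auto simp: indicator_le_1)
  moreover have "(\<lambda>x. (indicator ?B x :: real)\<^sup>2) = indicator ?B" by (auto simp: indicator_def)
  ultimately have "(measure P ?B)\<^sup>2 \<le> 2 * measure Q ?B"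
    using B sp by simp
  moreover have "measure P ?B = 1 - measure P A"
    using P.prob_compl[of A] assms sp by simp
  ultimately have "1 + measure P A * measure P A \<le> 2 * measure P A + 2 * measure Q ?B"
    by (simp add: power2_eq_square algebra_simps)
  then show ?thesis using zero_le_square[of "measure P A"] by linarith
qed

section \<open>Comparing integrals under likelihood-ratio bounds\<close>

lemma integral_mono_scaled_measure:
  fixes f :: "'a \<Rightarrow> real"
  assumes "prob_space M" "prob_space N" "sets M = sets N" "0 \<le> c"
    and le: "\<And>A. A \<in> sets N \<Longrightarrow> emeasure M A \<le> ennreal c * emeasure N A"
    and f[measurable]: "f \<in> borel_measurable N" and b: "\<And>x. x \<in> space N \<Longrightarrow> 0 \<le> f x \<and> f x \<le> K"
  shows "integral\<^sup>L M f \<le> c * integral\<^sup>L N f"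
proof -
  have sp: "space M = space N" using assms(3) by (rule sets_eq_imp_space_eq)
  have fM: "f \<in> borel_measurable M" by (rule borel_measurable_cong_sets[OF assms(3) f])
  have iM: "integrable M f" by (rule prob_integrable_bounded[OF assms(1) fM, of K]) (use b sp in force)
  have iN: "integrable N f" by (rule prob_integrable_bounded[OF assms(2) f, of K]) (use b in force)
  have nn: "integral\<^sup>L N f \<ge> 0" "integral\<^sup>L M f \<ge> 0" using b sp by (auto intro!: integral_nonneg_AE)
  have "M \<le> scale_measure (ennreal c) N"
    using le assms(3) by (subst le_measure) auto
  then have "(\<integral>\<^sup>+x. ennreal (f x) \<partial>M) \<le> (\<integral>\<^sup>+x. ennreal (f x) \<partial>scale_measure (ennreal c) N)"
    using assms(3) by (intro nn_integral_mono_measure) auto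
  also have "\<dots> = ennreal c * (\<integral>\<^sup>+x. ennreal (f x) \<partial>N)"
    by (rule nn_integral_scale_measure) measurable
  finally have "ennreal (integral\<^sup>L M f) \<le> ennreal (c * integral\<^sup>L N f)"
    using iM iN b sp nn assms(4)
    by (subst (asm) (1 2) nn_integral_eq_integral) (auto simp: ennreal_mult)
  then show ?thesis using nn assms(4) by (simp add: ennreal_le_iff)
qed

text \<open>A ratio bound controls only integrals of nonnegative functions, so \<open>f\<close> is
  split into its positive part \<open>g\<close> and its negative part \<open>h\<close>. On each part
  the difference of the two integrals is at most c - 1 times one of them, and moving that one to
  \<open>L\<close> costs a further factor c.\<close>

lemma integral_diff_le_of_ratio:
  fixes f :: "'a \<Rightarrow> real"
  assumes "prob_space M" "prob_space N" "prob_space L" "sets M = sets L" "sets N = sets L" "1 \<le> c"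
    and M_N: "\<And>A. A \<in> sets L \<Longrightarrow> emeasure M A \<le> ennreal c * emeasure N A"
    and N_M: "\<And>A. A \<in> sets L \<Longrightarrow> emeasure N A \<le> ennreal c * emeasure M A"
    and M_L: "\<And>A. A \<in> sets L \<Longrightarrow> emeasure M A \<le> ennreal c * emeasure L A"
    and N_L: "\<And>A. A \<in> sets L \<Longrightarrow> emeasure N A \<le> ennreal c * emeasure L A"
    and f[measurable]: "f \<in> borel_measurable L" and b: "\<And>x. x \<in> space L \<Longrightarrow> \<bar>f x\<bar> \<le> K"
  shows "integral\<^sup>L M f - integral\<^sup>L N f \<le> (c - 1) * c * (\<integral>x. \<bar>f x\<bar> \<partial>L)"
proof -
  have sp: "space M = space L" "space N = space L"
    using assms(4,5) by (auto dest: sets_eq_imp_space_eq)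
  define g h where "g x = max 0 (f x)" and "h x = max 0 (- f x)" for x
  have g[measurable]: "g \<in> borel_measurable L" and h[measurable]: "h \<in> borel_measurable L"
    unfolding g_def h_def by measurable
  have gb: "0 \<le> g x \<and> g x \<le> K" and hb: "0 \<le> h x \<and> h x \<le> K" if "x \<in> space L" for x
    using b[OF that] by (auto simp: g_def h_def)
  have int: "integrable X g" "integrable X h" if "X = M \<or> X = N \<or> X = L" for X
  proof -
    have X: "prob_space X" "sets X = sets L" using that assms(1-5) by auto
    show "integrable X g" "integrable X h"
      using gb hb sets_eq_imp_space_eq[OF X(2)]
      by (auto intro!: prob_integrable_bounded[OF X(1), of _ K] borel_measurable_cong_sets[OF X(2)])
  qed
  have fgh: "f = (\<lambda>x. g x - h x)" "(\<lambda>x. \<bar>f x\<bar>) = (\<lambda>x. g x + h x)"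
    by (auto simp: g_def h_def fun_eq_iff)
  have m: "integral\<^sup>L X u \<le> c * integral\<^sup>L Y u"
    if "prob_space X" "prob_space Y" "sets X = sets L" "sets Y = sets L" "u = g \<or> u = h"
      "\<And>A. A \<in> sets L \<Longrightarrow> emeasure X A \<le> ennreal c * emeasure Y A" for X Y u
  proof (rule integral_mono_scaled_measure[where K=K])
    show "u \<in> borel_measurable Y"
      using that(5) by (auto intro: borel_measurable_cong_sets[OF that(4)])
  qed (use that assms(6) gb hb sets_eq_imp_space_eq[OF that(4)] in auto)
  have "integral\<^sup>L M g - integral\<^sup>L N g \<le> (c - 1) * integral\<^sup>L N g"
    using m[of M N g] assms by (simp add: algebra_simps)
  also have "\<dots> \<le> (c - 1) * (c * integral\<^sup>L L g)"
    using m[of N L g] assms by (intro mult_left_mono) auto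
  finally have 1: "integral\<^sup>L M g - integral\<^sup>L N g \<le> (c - 1) * c * integral\<^sup>L L g" by simp
  \<comment> \<open>The negative part enters \<open>f\<close> with a minus sign, so \<open>M\<close>
    and \<open>N\<close> exchange roles.\<close>
  have "integral\<^sup>L N h - integral\<^sup>L M h \<le> (c - 1) * integral\<^sup>L M h"
    using m[of N M h] assms by (simp add: algebra_simps)
  also have "\<dots> \<le> (c - 1) * (c * integral\<^sup>L L h)"
    using m[of M L h] assms by (intro mult_left_mono) auto
  finally have 2: "integral\<^sup>L N h - integral\<^sup>L M h \<le> (c - 1) * c * integral\<^sup>L L h" by simp
  have "integral\<^sup>L M f - integral\<^sup>L N f = (integral\<^sup>L M g - integral\<^sup>L N g) + (integral\<^sup>L N h - integral\<^sup>L M h)"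
    unfolding fgh(1) using int by (subst (1 2) Bochner_Integration.integral_diff) auto
  also have "\<dots> \<le> (c - 1) * c * (integral\<^sup>L L g + integral\<^sup>L L h)"
    using 1 2 by (simp add: algebra_simps)
  also have "integral\<^sup>L L g + integral\<^sup>L L h = (\<integral>x. \<bar>f x\<bar> \<partial>L)"
    unfolding fgh(2) using int[of L] by (subst Bochner_Integration.integral_add) auto
  finally show ?thesis .
qed

text \<open>Only the centred test function matters in the perturbation term, which is why its
  contribution is of second order in \<open>\<eta>\<close>.\<close>

lemma chi2_bounded_perturb:
  assumes M: "prob_space M" "sets M = sets L" and N: "prob_space N" "sets N = sets L"
    and L: "prob_space L" and K: "prob_space K" "sets K = sets L" and "1 \<le> c"
    and M_N: "\<And>A. A \<in> sets L \<Longrightarrow> emeasure M A \<le> ennreal c * emeasure N A"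
    and N_M: "\<And>A. A \<in> sets L \<Longrightarrow> emeasure N A \<le> ennreal c * emeasure M A"
    and M_L: "\<And>A. A \<in> sets L \<Longrightarrow> emeasure M A \<le> ennreal c * emeasure L A"
    and N_L: "\<And>A. A \<in> sets L \<Longrightarrow> emeasure N A \<le> ennreal c * emeasure L A"
    and KL: "\<And>f. f \<in> borel_measurable L \<Longrightarrow> (\<And>x. x \<in> space L \<Longrightarrow> 0 \<le> f x \<and> f x \<le> 1) \<Longrightarrow>
      integral\<^sup>L K f = integral\<^sup>L L f + \<eta> * (integral\<^sup>L M f - integral\<^sup>L N f)"
  shows "chi2_bounded (1 + (\<eta> * ((c - 1) * c))\<^sup>2) K L"
  unfolding chi2_bounded_def
proof (intro ballI impI)
  interpret L: prob_space L by fact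
  interpret M: prob_space M by fact
  interpret N: prob_space N by fact
  have sp: "space M = space L" "space N = space L" "space K = space L"
    using M N K by (auto dest: sets_eq_imp_space_eq)
  fix f :: "'a \<Rightarrow> real"
  assume f[measurable]: "f \<in> borel_measurable L" and b: "\<forall>x\<in>space L. 0 \<le> f x \<and> f x \<le> 1"
  define F where "F = integral\<^sup>L L f"
  define \<rho> where "\<rho> = (c - 1) * c"
  have F: "0 \<le> F" "F \<le> 1" unfolding F_def using prob_integral_unit[OF L f] b by auto
  define g where "g x = f x - F" for x
  have g[measurable]: "g \<in> borel_measurable L" unfolding g_def by measurable
  have gb: "\<bar>g x\<bar> \<le> 1" if "x \<in> space L" for x using b that F by (force simp: g_def)
  have intf: "integrable M f" "integrable N f" "integrable L f"
    using M N L b sp f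
    by (auto intro!: prob_integrable_bounded[of _ _ 1] intro: borel_measurable_cong_sets)
  have g2: "integrable L (\<lambda>x. (g x)\<^sup>2)" "integrable L (\<lambda>x. (f x)\<^sup>2)" "integrable L (\<lambda>x. \<bar>g x\<bar>)"
    using gb b L by (auto intro!: prob_integrable_bounded[of _ _ 1] simp: power_le_one abs_square_le_1)
  \<comment> \<open>\<open>M\<close> and \<open>N\<close> both have total mass 1, so the constant
    \<open>F\<close> cancels.\<close>
  have MNg: "integral\<^sup>L M f - integral\<^sup>L N f = integral\<^sup>L M g - integral\<^sup>L N g"
    unfolding g_def using intf by (simp add: M.prob_space N.prob_space)
  have "integral\<^sup>L M g - integral\<^sup>L N g \<le> \<rho> * (\<integral>x. \<bar>g x\<bar> \<partial>L)" unfolding \<rho>_def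
    by (rule integral_diff_le_of_ratio[where K=1]) (use assms gb in auto)
  moreover have "integral\<^sup>L N g - integral\<^sup>L M g \<le> \<rho> * (\<integral>x. \<bar>g x\<bar> \<partial>L)" unfolding \<rho>_def
    by (rule integral_diff_le_of_ratio[where K=1]) (use assms gb in auto)
  ultimately have "\<bar>integral\<^sup>L M f - integral\<^sup>L N f\<bar> \<le> \<rho> * (\<integral>x. \<bar>g x\<bar> \<partial>L)"
    unfolding MNg by linarith
  then have "(integral\<^sup>L M f - integral\<^sup>L N f)\<^sup>2 \<le> (\<rho> * (\<integral>x. \<bar>g x\<bar> \<partial>L))\<^sup>2"
    using abs_le_square_iff by (metis abs_ge_self order_trans)
  also have "\<dots> = \<rho>\<^sup>2 * (\<integral>x. \<bar>g x\<bar> \<partial>L)\<^sup>2" by (simp add: power_mult_distrib)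
  \<comment> \<open>The variance of |g| is nonnegative; this passes from the L1 norm of the centred
    function to the variance of \<open>f\<close> under \<open>L\<close>, called \<open>V\<close>
    below.\<close>
  also have "(\<integral>x. \<bar>g x\<bar> \<partial>L)\<^sup>2 \<le> (\<integral>x. (g x)\<^sup>2 \<partial>L)"
    using L.variance_positive[of "\<lambda>x. \<bar>g x\<bar>"] L.variance_eq[of "\<lambda>x. \<bar>g x\<bar>"] g2 by auto
  also have "(\<integral>x. (g x)\<^sup>2 \<partial>L) = (\<integral>x. (f x)\<^sup>2 \<partial>L) - F\<^sup>2"
    using L.variance_eq[of f] intf g2 by (simp add: g_def F_def)
  finally have R: "(integral\<^sup>L M f - integral\<^sup>L N f)\<^sup>2 \<le> \<rho>\<^sup>2 * ((\<integral>x. (f x)\<^sup>2 \<partial>L) - F\<^sup>2)"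
    by (simp add: mult_left_mono)
  define R V where "R = integral\<^sup>L M f - integral\<^sup>L N f" and "V = (\<integral>x. (f x)\<^sup>2 \<partial>L) - F\<^sup>2"
  have V: "V \<ge> 0" unfolding V_def F_def
    using L.variance_positive[of f] L.variance_eq[of f] intf g2 by simp
  have "(\<eta> * R)\<^sup>2 \<le> (\<eta> * \<rho>)\<^sup>2 * V"
    using mult_left_mono[OF R, of "\<eta>\<^sup>2"] by (simp add: R_def V_def power_mult_distrib mult.assoc)
  then have "(\<eta> * R)\<^sup>2 \<le> (\<bar>\<eta> * \<rho>\<bar> * sqrt V)\<^sup>2" using V by (simp add: power_mult_distrib)
  then have "\<bar>\<eta> * R\<bar> \<le> \<bar>\<eta> * \<rho>\<bar> * sqrt V"
    using V by (metis abs_ge_zero abs_le_square_iff abs_of_nonneg mult_nonneg_nonneg real_sqrt_ge_zero)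
  then have "(F + \<eta> * R)\<^sup>2 \<le> (F + \<bar>\<eta> * \<rho>\<bar> * sqrt V)\<^sup>2"
    using F V by (intro power2_le_iff_abs_le[THEN iffD2]) (auto intro!: order_trans[OF abs_triangle_ineq] simp del: abs_mult)
  \<comment> \<open>Cauchy-Schwarz for the vectors (1, s) and (F, sqrt V) with s = |\<eta> \<rho>|.
    The sum F^2 + V is the second moment of \<open>f\<close> under \<open>L\<close>, which is the
    right-hand side needed.\<close>
  also have "\<dots> \<le> (1 + \<bar>\<eta> * \<rho>\<bar>\<^sup>2) * (F\<^sup>2 + (sqrt V)\<^sup>2)"
  proof -
    have "0 \<le> (\<bar>\<eta> * \<rho>\<bar> * F - sqrt V)\<^sup>2" by simp
    then show ?thesis by (simp add: power2_eq_square algebra_simps)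
  qed
  also have "F\<^sup>2 + (sqrt V)\<^sup>2 = (\<integral>x. (f x)\<^sup>2 \<partial>L)" using V by (simp add: V_def)
  finally show "(\<integral>x. f x \<partial>K)\<^sup>2 \<le> (1 + (\<eta> * ((c - 1) * c))\<^sup>2) * (\<integral>x. (f x)\<^sup>2 \<partial>L)"
    using KL[OF f] b by (simp add: F_def R_def \<rho>_def)
qed

section \<open>Assouad's argument on the hypercube\<close>

abbreviation sgn_bool :: "bool \<Rightarrow> real" where
  "sgn_bool b \<equiv> (if b then 1 else -1)"

text \<open>\<open>A i\<close> is the event of deciding against a true bit \<open>i\<close>, so
  \<open>E v i\<close> is the error probability for that bit. Pairing each \<open>v\<close> with its
  flip at \<open>i\<close> makes the average of \<open>E v i\<close> over the hypercube at least 1/4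
  for every \<open>i\<close>; some \<open>v\<close> does at least as badly as the average of the
  sum.\<close>

lemma assouad_chi2:
  fixes P :: "('n::finite \<Rightarrow> bool) \<Rightarrow> 'a measure"
  assumes "\<And>v. prob_space (P v)" and s: "\<And>v. sets (P v) = sets M" and A: "\<And>i. A i \<in> sets M"
    and chi: "\<And>v i. chi2_bounded 2 (P v) (P (v(i := \<not> v i)))"
  shows "\<exists>v. real CARD('n) / 4 \<le> (\<Sum>i\<in>UNIV. measure (P v) (if v i then A i else space M - A i))"
proof (rule ccontr)
  define E where "E v i = measure (P v) (if v i then A i else space M - A i)" for v i
  define N where "N = real CARD('n \<Rightarrow> bool)"
  have sp: "space (P v) = space M" for v using s by (rule sets_eq_imp_space_eq)
  have test: "1/2 \<le> E v i + E (v(i := \<not> v i)) i" for v i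
  proof (cases "v i")
    case True
    then show ?thesis
      using chi2_bounded_testing[OF assms(1,1) _ chi, of v i "A i"] s A sp by (simp add: E_def)
  next
    case False
    \<comment> \<open>The two-point bound needs the law with the true bit as its first argument, so
      the hypothesis is used at the flipped vertex.\<close>
    have "chi2_bounded 2 (P (v(i := True))) (P v)" using chi[of "v(i := True)" i] False
      by (simp add: fun_upd_idem)
    then show ?thesis
      using chi2_bounded_testing[OF assms(1,1), of "v(i := True)" v "A i"] s A sp False by (simp add: E_def)
  qed
  have "N / 4 \<le> (\<Sum>v\<in>UNIV. E v i)" for i
  proof -
    \<comment> \<open>Flipping bit \<open>i\<close> is an involution of the hypercube.\<close>
    have "(\<Sum>v\<in>UNIV. E (v(i := \<not> v i)) i) = (\<Sum>v\<in>UNIV. E v i)"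
      by (rule sum.reindex_bij_witness[of _ "\<lambda>v. v(i := \<not> v i)" "\<lambda>v. v(i := \<not> v i)"]) auto
    moreover have "(\<Sum>v\<in>(UNIV :: ('n \<Rightarrow> bool) set). 1/2) \<le> (\<Sum>v\<in>UNIV. E v i + E (v(i := \<not> v i)) i)"
      by (intro sum_mono test)
    ultimately show ?thesis by (simp add: sum.distrib N_def)
  qed
  then have "(\<Sum>i\<in>(UNIV::'n set). N / 4) \<le> (\<Sum>i\<in>UNIV. \<Sum>v\<in>UNIV. E v i)" by (intro sum_mono)
  also have "\<dots> = (\<Sum>v\<in>UNIV. \<Sum>i\<in>UNIV. E v i)" by (rule sum.swap)
  finally have 1: "real CARD('n) * (N / 4) \<le> (\<Sum>v\<in>UNIV. \<Sum>i\<in>UNIV. E v i)" by simp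
  assume "\<nexists>v. real CARD('n) / 4 \<le> (\<Sum>i\<in>UNIV. measure (P v) (if v i then A i else space M - A i))"
  then have "(\<Sum>i\<in>UNIV. E v i) < real CARD('n) / 4" for v by (simp add: E_def not_le)
  then have "(\<Sum>v\<in>UNIV. \<Sum>i\<in>UNIV. E v i) < (\<Sum>v\<in>(UNIV :: ('n \<Rightarrow> bool) set). real CARD('n) / 4)"
    by (intro sum_strict_mono) auto
  then show False using 1 by (simp add: N_def algebra_simps)
qed

subsection \<open>The sparse oracle\<close>

text \<open>Sparsity serves twice: a multiple of a unit vector has the same norm for every exponent,
  and the bit \<open>v i\<close> influences only the draws in coordinate \<open>i\<close>, which
  have probability 1/d.\<close>

definition spike_pmf :: "real \<Rightarrow> real \<Rightarrow> ('n::finite \<Rightarrow> bool) \<Rightarrow> (real^'n) pmf" where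
  "spike_pmf B \<delta> v = bind_pmf (pmf_of_set UNIV) (\<lambda>i. map_pmf (\<lambda>b. (B * sgn_bool b) *\<^sub>R axis i 1)
     (bernoulli_pmf ((1 + \<delta> * sgn_bool (v i)) / 2)))"

text \<open>The same law moved to the Borel sigma-algebra: a pmf measures every set, whereas oracles
  and channels are kernels on \<open>borel\<close>.\<close>

definition spike :: "real \<Rightarrow> real \<Rightarrow> ('n::finite \<Rightarrow> bool) \<Rightarrow> (real^'n) measure" where
  "spike B \<delta> v = distr (measure_pmf (spike_pmf B \<delta> v)) borel (\<lambda>x. x)"

lemma spike_in_prob_algebra: "spike B \<delta> v \<in> space (prob_algebra borel)"
  by (auto simp: spike_def space_prob_algebra measure_pmf.prob_space_distr)

lemma expectation_spike_pmf:
  fixes h :: "real^'n \<Rightarrow> 'b::{banach, second_countable_topology}"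
  assumes "0 \<le> \<delta>" "\<delta> \<le> 1"
  shows "measure_pmf.expectation (spike_pmf B \<delta> v) h = (1 / real CARD('n)) *\<^sub>R
    (\<Sum>i\<in>UNIV. ((1 + \<delta> * sgn_bool (v i)) / 2) *\<^sub>R h (B *\<^sub>R axis i 1)
      + ((1 - \<delta> * sgn_bool (v i)) / 2) *\<^sub>R h ((- B) *\<^sub>R axis i 1))"
proof -
  have b: "measure_pmf.expectation (bernoulli_pmf p) g = p *\<^sub>R g True + (1 - p) *\<^sub>R g False"
    if "0 \<le> p" "p \<le> 1" for p and g :: "bool \<Rightarrow> 'b"
    using that by (subst integral_measure_pmf[of UNIV]) (auto simp: UNIV_bool)
  show ?thesis unfolding spike_pmf_def
    by (subst pmf_expectation_bind_pmf_of_set)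
       (use assms in \<open>auto simp: b scaleR_sum_right divide_simps intro!: sum.cong\<close>)
qed

lemma integral_spike:
  fixes h :: "real^'n \<Rightarrow> 'b::{banach, second_countable_topology}"
  assumes "0 \<le> \<delta>" "\<delta> \<le> 1" "h \<in> borel_measurable borel"
  shows "integral\<^sup>L (spike B \<delta> v) h = (1 / real CARD('n)) *\<^sub>R
    (\<Sum>i\<in>UNIV. ((1 + \<delta> * sgn_bool (v i)) / 2) *\<^sub>R h (B *\<^sub>R axis i 1)
      + ((1 - \<delta> * sgn_bool (v i)) / 2) *\<^sub>R h ((- B) *\<^sub>R axis i 1))"
  unfolding spike_def using assms
  by (subst integral_distr) (auto simp: expectation_spike_pmf)

text \<open>Only the \<open>i\<close>-th summand sees the flipped bit, and its two weights move by
  \<delta> in opposite directions. The result has the form of the perturbation hypothesis of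
  \<open>chi2_bounded_perturb\<close>.\<close>

lemma integral_spike_flip:
  fixes h :: "real^'n \<Rightarrow> real"
  assumes "0 \<le> \<delta>" "\<delta> \<le> 1" "h \<in> borel_measurable borel"
  shows "integral\<^sup>L (spike B \<delta> v) h = integral\<^sup>L (spike B \<delta> (v(i := \<not> v i))) h
    + (\<delta> * sgn_bool (v i) / real CARD('n)) * (h (B *\<^sub>R axis i 1) - h ((- B) *\<^sub>R axis i 1))"
  unfolding integral_spike[OF assms] sum.remove[OF finite_class.finite_UNIV UNIV_I, of _ i]
  by (simp add: field_simps)

lemma AE_spike: "AE g in (spike B \<delta> v :: (real^'n) measure). \<exists>i. g = B *\<^sub>R axis i 1 \<or> g = (- B) *\<^sub>R axis i 1"
proof -
  define F :: "(real^'n) set" where "F = (\<Union>i. {B *\<^sub>R axis i 1, (- B) *\<^sub>R axis i 1})"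
  have "AE g in spike B \<delta> v. g \<in> F" unfolding spike_def
    by (subst AE_distr_iff)
      (auto simp: F_def AE_measure_pmf_iff spike_pmf_def intro!: borel_closed finite_imp_closed split: if_splits)
  then show ?thesis by (rule AE_mp) (auto simp: F_def)
qed

lemma mean_spike:
  assumes "0 \<le> \<delta>" "\<delta> \<le> 1"
  shows "(\<integral>g. g \<partial>(spike B \<delta> v :: (real^'n) measure)) = (\<chi> i. B * \<delta> / real CARD('n) * sgn_bool (v i))"
proof -
  have two: "((1 + x) / 2) *\<^sub>R (B *\<^sub>R e) + ((1 - x) / 2) *\<^sub>R ((- B) *\<^sub>R e) = (B * x) *\<^sub>R e"
    for x :: real and e :: "real^'n"
  proof -
    have "(1 + x) / 2 * B + (1 - x) / 2 * (- B) = B * x" by (simp add: field_simps)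
    then show ?thesis by (simp only: scaleR_scaleR scaleR_left_distrib[symmetric])
  qed
  have "(\<integral>g. g \<partial>(spike B \<delta> v :: (real^'n) measure)) =
    (1 / real CARD('n)) *\<^sub>R (\<Sum>i\<in>UNIV. (B * (\<delta> * sgn_bool (v i))) *\<^sub>R axis i 1)"
    by (subst integral_spike[OF assms measurable_ident_sets[OF refl]]) (simp only: two)
  also have "\<dots> = (\<chi> i. B * \<delta> / real CARD('n) * sgn_bool (v i))"
    by (simp add: vec_eq_iff axis_def if_distrib[where f="\<lambda>c. _ * c"] cong: if_cong)
  finally show ?thesis .
qed

text \<open>Applying \<open>integral_spike_flip\<close> to the mean of a test function under
  \<open>W x\<close>, as a function of \<open>x\<close>, shows that the two output laws differ by
  \<plusminus> \<delta>/d times the difference of two channel laws. Privacy makes these comparable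
  with ratio c = exp \<epsilon>, so \<open>chi2_bounded_perturb\<close> applies.\<close>

lemma chi2_bounded_private_step:
  fixes W :: "real^'n \<Rightarrow> (real^'n) measure"
  assumes W: "priv_channel \<epsilon> W" and "0 \<le> \<epsilon>" and \<delta>: "0 \<le> \<delta>" "\<delta> \<le> 1"
  shows "chi2_bounded (1 + (\<delta> / real CARD('n) * ((exp \<epsilon> - 1) * exp \<epsilon>))\<^sup>2)
    (spike B \<delta> v \<bind> W) (spike B \<delta> (v(i := \<not> v i)) \<bind> W)"
proof -
  have Wm[measurable]: "W \<in> borel \<rightarrow>\<^sub>M prob_algebra borel" using W by (simp add: priv_channel_def channel_def)
  have ratio: "emeasure (W x) S \<le> ennreal (exp \<epsilon>) * emeasure (W x') S" if "S \<in> sets borel" for x x' S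
    using W that by (simp add: priv_channel_def)
  have Wp: "prob_space (W x)" "sets (W x) = sets borel" for x
    using prob_kernelD[OF Wm, of x] by auto
  let ?L = "spike B \<delta> (v(i := \<not> v i)) \<bind> W" and ?K = "spike B \<delta> v \<bind> W"
  have KL: "prob_space ?K" "prob_space ?L" "sets ?K = sets borel" "sets ?L = sets borel"
    by (intro prob_space_bind'[OF spike_in_prob_algebra Wm] sets_bind'[OF spike_in_prob_algebra Wm])+
  \<comment> \<open>Averaging the privacy inequality over the second input \<open>y\<close>, drawn
    from the oracle, dominates each \<open>W x\<close> by the mixture.\<close>
  have dom: "emeasure (W x) S \<le> ennreal (exp \<epsilon>) * emeasure ?L S" if S: "S \<in> sets borel" for x S
  proof -
    let ?O = "spike B \<delta> (v(i := \<not> v i))"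
    interpret O: prob_space ?O using spike_in_prob_algebra by (auto simp: space_prob_algebra)
    have [measurable_cong]: "sets ?O = sets borel" by (simp add: spike_def)
    have [measurable]: "W \<in> borel \<rightarrow>\<^sub>M subprob_algebra borel" by (rule measurable_prob_algebraD[OF Wm])
    have "emeasure (W x) S = (\<integral>\<^sup>+y. emeasure (W x) S \<partial>?O)" by (simp add: O.emeasure_space_1)
    also have "\<dots> \<le> (\<integral>\<^sup>+y. ennreal (exp \<epsilon>) * emeasure (W y) S \<partial>?O)"
      by (intro nn_integral_mono ratio S)
    also have "\<dots> = ennreal (exp \<epsilon>) * emeasure ?L S"
      using S by (subst nn_integral_cmult) (auto simp: emeasure_bind_prob_algebra[OF spike_in_prob_algebra Wm])
    finally show ?thesis .
  qed
  have "chi2_bounded (1 + (\<delta> * sgn_bool (v i) / real CARD('n) * ((exp \<epsilon> - 1) * exp \<epsilon>))\<^sup>2) ?K ?L"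
  proof (rule chi2_bounded_perturb[where M="W (B *\<^sub>R axis i 1)" and N="W ((- B) *\<^sub>R axis i 1)"])
    fix f :: "real^'n \<Rightarrow> real"
    assume "f \<in> borel_measurable ?L" and b: "\<And>x. x \<in> space ?L \<Longrightarrow> 0 \<le> f x \<and> f x \<le> 1"
    then have f: "f \<in> borel_measurable borel"
      using borel_measurable_cong_sets[OF KL(4)[symmetric]] by blast
    have b: "\<bar>f x\<bar> \<le> 1" for x using b[of x] sets_eq_imp_space_eq[OF KL(4)] by auto
    have m: "(\<lambda>x. integral\<^sup>L (W x) f) \<in> borel_measurable borel"
      by (rule measurable_compose[OF measurable_prob_algebraD[OF Wm] integral_measurable_subprob_algebra[OF f]])
    show "integral\<^sup>L ?K f = integral\<^sup>L ?L f + (\<delta> * sgn_bool (v i) / real CARD('n))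
        * (integral\<^sup>L (W (B *\<^sub>R axis i 1)) f - integral\<^sup>L (W ((- B) *\<^sub>R axis i 1)) f)"
      by (simp only: integral_bind_prob[OF spike_in_prob_algebra Wm f b] integral_spike_flip[OF \<delta> m, of B v i])
  qed (use KL Wp ratio dom \<open>0 \<le> \<epsilon>\<close> in auto)
  \<comment> \<open>The sign of the bit disappears in the square.\<close>
  then show ?thesis by (cases "v i") simp_all
qed

subsection \<open>The interaction process\<close>

abbreviation run_space :: "(real \<times> (nat \<Rightarrow> real^'n)) measure" where
  "run_space \<equiv> borel \<Otimes>\<^sub>M hist_space"

text \<open>One round against an oracle whose law \<open>G\<close> is the same at every point. The
  query rule drops out of the transition, so adaptive queries gain nothing against such an
  oracle.\<close>

definition step_kernel :: "(nat \<Rightarrow> (nat \<Rightarrow> real^'n) \<Rightarrow> real^'n \<Rightarrow> (real^'n) measure) \<Rightarrow> (real^'n) measure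
    \<Rightarrow> nat \<Rightarrow> real \<times> (nat \<Rightarrow> real^'n) \<Rightarrow> (real \<times> (nat \<Rightarrow> real^'n)) measure" where
  "step_kernel S G t uh = distr (G \<bind> S t (snd uh)) run_space (\<lambda>y. (fst uh, (snd uh)(t := y)))"

lemma process_const_Suc:
  "process \<mu> query S (\<lambda>_. G) (Suc t) = process \<mu> query S (\<lambda>_. G) t \<bind> step_kernel S G t"
  by (simp add: step_kernel_def[abs_def])

lemma measurable_record: "(\<lambda>(uh, y). (fst uh, (snd uh)(t := y))) \<in> run_space \<Otimes>\<^sub>M borel \<rightarrow>\<^sub>M run_space"
  unfolding split_beta'
  by (intro measurable_Pair measurable_fun_upd[where J=UNIV]) auto

lemma measurable_step_kernel:
  assumes "strategy \<epsilon> S" "G \<in> space (prob_algebra borel)"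
  shows "step_kernel S G t \<in> run_space \<rightarrow>\<^sub>M prob_algebra run_space"
  unfolding step_kernel_def
proof (rule measurable_distr_prob_space2[where M=borel, OF measurable_bind_prob_space2[where N=borel] measurable_record])
  show "(\<lambda>_. G) \<in> run_space \<rightarrow>\<^sub>M prob_algebra borel" using assms(2) by simp
  have S: "(\<lambda>hg. S t (fst hg) (snd hg)) \<in> (hist_space \<Otimes>\<^sub>M borel) \<rightarrow>\<^sub>M prob_algebra borel"
    using assms(1) by (simp add: strategy_def)
  have "(\<lambda>z. (snd (fst z), snd z)) \<in> run_space \<Otimes>\<^sub>M borel \<rightarrow>\<^sub>M hist_space \<Otimes>\<^sub>M borel" by measurable
  from measurable_compose[OF this S]
  show "(\<lambda>(uh, y). S t (snd uh) y) \<in> run_space \<Otimes>\<^sub>M borel \<rightarrow>\<^sub>M prob_algebra borel"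
    by (simp add: split_beta')
qed

lemma process_in_prob_algebra:
  assumes "prob_space \<mu>" "sets \<mu> = sets borel" "strategy \<epsilon> S" "G \<in> space (prob_algebra borel)"
  shows "process \<mu> query S (\<lambda>_. G) t \<in> space (prob_algebra run_space)"
proof (induction t)
  case 0
  have "(\<lambda>u. (u, \<lambda>_. 0)) \<in> borel \<rightarrow>\<^sub>M run_space"
    by (intro measurable_Pair measurable_const) (auto simp: space_PiM)
  then have "(\<lambda>u. (u, \<lambda>_. 0)) \<in> \<mu> \<rightarrow>\<^sub>M run_space" by (subst measurable_cong_sets[OF assms(2) refl])
  from prob_space.prob_space_distr[OF assms(1) this] show ?case by (simp add: space_prob_algebra)
next
  case (Suc t)
  note m = measurable_step_kernel[OF assms(3,4), of t]
  show ?case unfolding process_const_Suc space_prob_algebra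
    using prob_space_bind'[OF Suc m] sets_bind'[OF Suc m] by simp
qed

text \<open>Each round multiplies the constant by the one-step factor, uniformly in the past. That
  uniformity is what admits adaptively chosen channels.\<close>

lemma chi2_bounded_process:
  fixes S :: "nat \<Rightarrow> (nat \<Rightarrow> real^'n) \<Rightarrow> real^'n \<Rightarrow> (real^'n) measure"
  assumes \<mu>: "prob_space \<mu>" "sets \<mu> = sets borel" and S: "strategy \<epsilon> S" and "0 \<le> \<epsilon>"
    and \<delta>: "0 \<le> \<delta>" "\<delta> \<le> 1"
  shows "chi2_bounded ((1 + (\<delta> / real CARD('n) * ((exp \<epsilon> - 1) * exp \<epsilon>))\<^sup>2) ^ t)
    (process \<mu> query S (\<lambda>_. spike B \<delta> v) t) (process \<mu> query S (\<lambda>_. spike B \<delta> (v(i := \<not> v i))) t)"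
proof (induction t)
  \<comment> \<open>Before the first round only the seed is random, so the two laws
    coincide.\<close>
  case 0
  then show ?case
    using process_in_prob_algebra[OF \<mu> S spike_in_prob_algebra, of query B \<delta> v 0]
    by (auto simp: space_prob_algebra intro!: chi2_bounded_refl)
next
  case (Suc t)
  let ?\<beta> = "1 + (\<delta> / real CARD('n) * ((exp \<epsilon> - 1) * exp \<epsilon>))\<^sup>2"
  \<comment> \<open>Given the past, a round appends one privatised observation to the history. The
    data processing bound transfers the one-step estimate to this deterministic update.\<close>
  have step: "chi2_bounded ?\<beta> (step_kernel S (spike B \<delta> v) t uh)
      (step_kernel S (spike B \<delta> (v(i := \<not> v i))) t uh)" if uh: "uh \<in> space run_space" for uh
    unfolding step_kernel_def
  proof (rule chi2_bounded_distr)
    have W: "priv_channel \<epsilon> (S t (snd uh))" using S by (simp add: strategy_def)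
    then have Wm: "S t (snd uh) \<in> borel \<rightarrow>\<^sub>M prob_algebra borel" by (simp add: priv_channel_def channel_def)
    have sets: "sets (spike B \<delta> w \<bind> S t (snd uh)) = sets borel" for w
      by (rule sets_bind'[OF spike_in_prob_algebra Wm])
    show "chi2_bounded ?\<beta> (spike B \<delta> v \<bind> S t (snd uh)) (spike B \<delta> (v(i := \<not> v i)) \<bind> S t (snd uh))"
      by (rule chi2_bounded_private_step[OF W \<open>0 \<le> \<epsilon>\<close> \<delta>])
    have "(\<lambda>y. (fst uh, (snd uh)(t := y))) \<in> borel \<rightarrow>\<^sub>M run_space"
      using measurable_compose[OF measurable_Pair1'[OF uh] measurable_record[of t]] by simp
    then show "(\<lambda>y. (fst uh, (snd uh)(t := y))) \<in> (spike B \<delta> (v(i := \<not> v i)) \<bind> S t (snd uh)) \<rightarrow>\<^sub>M run_space"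
      by (subst measurable_cong_sets[OF sets refl])
    show "sets (spike B \<delta> v \<bind> S t (snd uh)) = sets (spike B \<delta> (v(i := \<not> v i)) \<bind> S t (snd uh))"
      by (simp only: sets)
  qed
  have "0 \<le> ?\<beta>" by (intro add_nonneg_nonneg zero_le_power2) simp
  then have "0 \<le> ?\<beta> ^ t" by (rule zero_le_power)
  from chi2_bounded_bind[OF process_in_prob_algebra[OF \<mu> S spike_in_prob_algebra]
      process_in_prob_algebra[OF \<mu> S spike_in_prob_algebra]
      measurable_step_kernel[OF S spike_in_prob_algebra] measurable_step_kernel[OF S spike_in_prob_algebra]
      Suc this step]
  show ?case unfolding process_const_Suc power_Suc2 .
qed

subsection \<open>The geometry of the hard instances\<close>

definition cube :: "real \<Rightarrow> (real^'n) set" where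
  "cube b = {x. \<forall>i. \<bar>x $ i\<bar> \<le> b}"

lemma convex_cube: "convex (cube b :: (real^'n) set)"
proof -
  have *: "\<bar>y\<bar> \<le> b \<longleftrightarrow> - b \<le> y \<and> y \<le> b" for y :: real by linarith
  have "cube b = (cbox (\<chi> i. - b) (\<chi> i. b) :: (real^'n) set)"
    by (rule set_eqI) (simp only: cube_def mem_box_cart mem_Collect_eq vec_lambda_beta *)
  then show ?thesis by (simp only: convex_box)
qed

lemma two_le_ereal_cases:
  assumes "2 \<le> (p::ereal)"
  obtains "p = \<infinity>" | r where "p = ereal r" "2 \<le> r"
  using assms by (cases p) auto

text \<open>The half-width makes the main diagonal of the cube have l_p length exactly
  \<open>D\<close>: the side is 2b and the diagonal is d^(1/p) times the side, with 1/p read as 0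
  for p = \<infinity>.\<close>

lemma cube_in_Xset:
  assumes p: "2 \<le> p" and "0 < D"
  shows "(cube (D / (2 * real CARD('n) powr inv_exp p)) :: (real^'n) set) \<in> Xset p D"
proof -
  define b where "b = D / (2 * real CARD('n) powr inv_exp p)"
  have b: "0 \<le> b" using assms by (simp add: b_def)
  have "lpnorm p (x - y) \<le> D" if "x \<in> cube b" "y \<in> cube b" for x y :: "real^'n"
  proof -
    have c: "\<bar>(x - y) $ i\<bar> \<le> 2 * b" for i
    proof -
      have "\<bar>x $ i\<bar> \<le> b" "\<bar>y $ i\<bar> \<le> b" using that by (auto simp: cube_def)
      then show ?thesis by simp
    qed
    show ?thesis using p
    proof (cases rule: two_le_ereal_cases)
      case 1
      then have "2 * b = D" by (simp add: b_def inv_exp_def)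
      then have "\<bar>(x - y) $ i\<bar> \<le> D" for i using c[of i] by simp
      then show ?thesis unfolding lpnorm_def using 1 by (simp del: vector_minus_component)
    next
      case (2 r)
      have "(\<Sum>i\<in>UNIV. \<bar>(x - y) $ i\<bar> powr r) \<le> (\<Sum>i\<in>(UNIV::'n set). (2 * b) powr r)"
        using c 2 by (intro sum_mono powr_mono2) auto
      also have "\<dots> = (real CARD('n) powr (1 / r) * (2 * b)) powr r"
        using 2 b by (simp add: powr_mult powr_powr)
      finally have "lpnorm p (x - y) \<le> ((real CARD('n) powr (1 / r) * (2 * b)) powr r) powr (1 / r)"
        using 2 by (simp add: lpnorm_def powr_mono2 sum_nonneg)
      also have "\<dots> = real CARD('n) powr (1 / r) * (2 * b)"
        using 2 b by (simp add: powr_powr)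
      also have "\<dots> = D" using 2 by (simp add: b_def inv_exp_def)
      finally show ?thesis .
    qed
  qed
  moreover have "(0 :: real^'n) \<in> cube b" using b by (simp add: cube_def)
  ultimately have "cube b \<in> (Xset p D :: (real^'n) set set)" unfolding Xset_def by auto
  then show ?thesis by (simp only: b_def)
qed

lemma lpnorm_axis:
  assumes "0 < r"
  shows "lpnorm (ereal r) (c *\<^sub>R axis i 1 :: real^'n) = \<bar>c\<bar>"
proof -
  have "(\<Sum>j\<in>UNIV. \<bar>(c *\<^sub>R axis i 1 :: real^'n) $ j\<bar> powr r) = (\<Sum>j\<in>UNIV. if j = i then \<bar>c\<bar> powr r else 0)"
    by (intro sum.cong) (auto simp: axis_def)
  then show ?thesis using assms by (simp add: lpnorm_def powr_powr)
qed

text \<open>As p = 1 is excluded, the gradients are never measured in the sup norm, and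
  \<open>lpnorm_axis\<close> covers all cases.\<close>

lemma conj_exp_finite:
  assumes "2 \<le> p"
  obtains r where "conj_exp p = ereal r" "0 < r"
  using assms
proof (cases rule: two_le_ereal_cases)
  case 1
  then show ?thesis using that[of 1] by (simp add: conj_exp_def one_ereal_def)
next
  case (2 r)
  then show ?thesis using that[of "r / (r - 1)"] by (simp add: conj_exp_def one_ereal_def)
qed

text \<open>The mean of the spike law, as computed in \<open>mean_spike\<close>.\<close>

definition slope :: "real \<Rightarrow> real \<Rightarrow> ('n::finite \<Rightarrow> bool) \<Rightarrow> real^'n" where
  "slope B \<delta> v = (\<chi> i. B * \<delta> / real CARD('n) * sgn_bool (v i))"

text \<open>A linear function has its slope as a subgradient at every point, so an oracle that
  ignores the query is legitimate.\<close>

lemma oracle_pair_spike: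
  assumes p: "2 \<le> p" and \<delta>: "0 \<le> \<delta>" "\<delta> \<le> 1"
  shows "oracle_pair p B (cube b) (\<lambda>x. slope B \<delta> v \<bullet> x) (\<lambda>_. spike B \<delta> v)"
  unfolding oracle_pair_def
proof (intro conjI ballI)
  show "convex_on (cube b) (\<lambda>x. slope B \<delta> v \<bullet> x)"
    by (simp add: convex_on_def convex_cube inner_add_right)
  show "(\<lambda>_. spike B \<delta> v) \<in> borel \<rightarrow>\<^sub>M prob_algebra borel"
    by (rule measurable_const[OF spike_in_prob_algebra])
  obtain r where r: "conj_exp p = ereal r" "0 < r" using conj_exp_finite[OF p] .
  show "AE g in spike B \<delta> v. (lpnorm (conj_exp p) g)\<^sup>2 \<le> B\<^sup>2"
    using AE_spike
  proof (rule AE_mp, intro AE_I2 impI)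
    fix g :: "real^'a" assume "\<exists>i. g = B *\<^sub>R axis i 1 \<or> g = (- B) *\<^sub>R axis i 1"
    then show "(lpnorm (conj_exp p) g)\<^sup>2 \<le> B\<^sup>2"
      unfolding r(1) by (elim exE disjE) (simp_all only: lpnorm_axis[OF r(2)] power2_abs power2_minus)
  qed
  show "(\<integral>g. g \<partial>spike B \<delta> v) \<in> subdiff (\<lambda>x. slope B \<delta> v \<bullet> x) (cube b) x" for x
    unfolding mean_spike[OF \<delta>] slope_def[symmetric] by (simp add: subdiff_def inner_diff_right)
qed

text \<open>On a cube the linear objective decouples. Above its minimum, coordinate \<open>i\<close>
  costs a (s x_i + b) with s the sign of the bit: never negative, and at least a b when s x_i \<ge>
  0. Ties at 0 count as errors only for a true bit, so that the error events for the two values of a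
  bit are complementary.\<close>

lemma slope_gap:
  fixes x :: "real^'n"
  assumes "0 \<le> B * \<delta>" "x \<in> cube b" "0 \<le> b"
  shows "(B * \<delta> / real CARD('n) * b) * (\<Sum>i\<in>UNIV. of_bool (if v i then 0 \<le> x $ i else x $ i < 0))
    \<le> slope B \<delta> v \<bullet> x - Inf ((\<lambda>x. slope B \<delta> v \<bullet> x) ` cube b)"
proof -
  define a where "a = B * \<delta> / real CARD('n)"
  have a: "0 \<le> a" using assms by (simp add: a_def)
  have ip: "slope B \<delta> v \<bullet> y = (\<Sum>i\<in>UNIV. a * (sgn_bool (v i) * y $ i))" for y
    by (simp add: inner_vec_def slope_def a_def mult.assoc)
  \<comment> \<open>The vertex opposite to the sign pattern, where every coordinate attains its
    lower bound.\<close>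
  define z :: "real^'n" where "z = (\<chi> i. - b * sgn_bool (v i))"
  have z: "z \<in> cube b" using assms by (simp add: z_def cube_def)
  have lb: "- a * b \<le> a * (sgn_bool (v i) * y $ i)" if "y \<in> cube b" for y i
  proof -
    have "\<bar>y $ i\<bar> \<le> b" using that by (simp add: cube_def)
    then have "- b \<le> sgn_bool (v i) * y $ i" by (cases "v i") auto
    from mult_left_mono[OF this a] show ?thesis by simp
  qed
  have "bdd_below ((\<lambda>x. slope B \<delta> v \<bullet> x) ` cube b)"
    by (rule bdd_belowI2[of _ "\<Sum>i\<in>(UNIV::'n set). - a * b"]) (use lb in \<open>auto simp only: ip intro!: sum_mono\<close>)
  then have "Inf ((\<lambda>x. slope B \<delta> v \<bullet> x) ` cube b) \<le> slope B \<delta> v \<bullet> z"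
    using z by (rule cINF_lower)
  also have "slope B \<delta> v \<bullet> z = (\<Sum>i\<in>(UNIV::'n set). - a * b)"
    unfolding ip by (intro sum.cong) (auto simp: z_def)
  finally have I: "Inf ((\<lambda>x. slope B \<delta> v \<bullet> x) ` cube b) \<le> (\<Sum>i\<in>(UNIV::'n set). - a * b)" .
  have "(a * b) * (\<Sum>i\<in>UNIV. of_bool (if v i then 0 \<le> x $ i else x $ i < 0))
      \<le> (\<Sum>i\<in>UNIV. a * (sgn_bool (v i) * x $ i) + a * b)"
    unfolding sum_distrib_left
  proof (rule sum_mono)
    fix i
    show "a * b * of_bool (if v i then 0 \<le> x $ i else x $ i < 0) \<le> a * (sgn_bool (v i) * x $ i) + a * b"
      using lb[OF assms(2), of i] a
      by (cases "if v i then 0 \<le> x $ i else x $ i < 0") (auto simp: mult_nonneg_nonneg mult_nonneg_nonpos split: if_splits)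
  qed
  also have "\<dots> = slope B \<delta> v \<bullet> x - (\<Sum>i\<in>(UNIV::'n set). - a * b)"
    unfolding ip by (simp add: sum.distrib)
  finally show ?thesis using I by (simp add: a_def)
qed

section \<open>From undecided bits to optimization error\<close>

lemma hard_instance:
  fixes query :: "nat \<Rightarrow> real \<Rightarrow> (nat \<Rightarrow> real^'n) \<Rightarrow> real^'n"
  assumes alg: "algorithm (cube b) \<mu> query outp" and S: "strategy \<epsilon> S" and "0 \<le> \<epsilon>"
    and \<delta>: "0 \<le> \<delta>" "\<delta> \<le> 1" and "0 \<le> B" "0 \<le> b"
    and small: "(1 + (\<delta> / real CARD('n) * ((exp \<epsilon> - 1) * exp \<epsilon>))\<^sup>2) ^ T \<le> 2"
  shows "\<exists>v. ennreal (B * \<delta> * b / 4) \<le>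
    opt_error (cube b) (\<lambda>x. slope B \<delta> v \<bullet> x) (\<lambda>_. spike B \<delta> v) \<mu> query outp S T"
proof -
  have \<mu>: "prob_space \<mu>" "sets \<mu> = sets borel"
    and om: "(\<lambda>uh. outp (fst uh) (snd uh)) \<in> run_space \<rightarrow>\<^sub>M borel"
    and oc: "\<And>u h. outp u h \<in> cube b"
    using alg by (auto simp: algorithm_def)
  define P where "P v = process \<mu> query S (\<lambda>_. spike B \<delta> v) T" for v
  \<comment> \<open>The minimiser has coordinate -b for a true bit, so a nonnegative output
    coordinate is a vote for a false bit.\<close>
  define A where "A i = {uh \<in> space run_space. 0 \<le> outp (fst uh) (snd uh) $ i}" for i
  have P: "prob_space (P v)" "sets (P v) = sets run_space" for v
    using process_in_prob_algebra[OF \<mu> S spike_in_prob_algebra] unfolding P_def space_prob_algebra by auto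
  have nth: "(\<lambda>x::real^'n. x $ i) \<in> borel_measurable borel" for i
    by (intro borel_measurable_continuous_onI continuous_intros)
  have A: "A i \<in> sets run_space" for i
  proof -
    have "(\<lambda>uh. outp (fst uh) (snd uh) $ i) \<in> borel_measurable run_space"
      by (rule measurable_compose[OF om nth])
    then show ?thesis unfolding A_def by (rule borel_measurable_le[OF borel_measurable_const])
  qed
  have "chi2_bounded 2 (P v) (P (v(i := \<not> v i)))" for v i
    unfolding P_def by (rule chi2_bounded_mono[OF chi2_bounded_process[OF \<mu> S \<open>0 \<le> \<epsilon>\<close> \<delta>] small])
  then have "\<exists>v. real CARD('n) / 4 \<le> (\<Sum>i\<in>UNIV. measure (P v) (if v i then A i else space run_space - A i))"
    by (intro assouad_chi2 P A)
  then obtain v where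
    v: "real CARD('n) / 4 \<le> (\<Sum>i\<in>UNIV. measure (P v) (if v i then A i else space run_space - A i))" by blast
  interpret prob_space "P v" by (rule P)
  define E where "E i = (if v i then A i else space run_space - A i)" for i
  have E: "E i \<in> sets (P v)" for i using A by (auto simp: E_def P)
  define c where "c = B * \<delta> / real CARD('n) * b"
  have c: "0 \<le> c" using assms by (simp add: c_def)
  \<comment> \<open>Each wrong bit costs \<open>c\<close>, and the expected number of wrong bits is
    at least d/4.\<close>
  have "B * \<delta> * b / 4 = c * (real CARD('n) / 4)" by (simp add: c_def)
  also have "\<dots> \<le> c * (\<Sum>i\<in>UNIV. measure (P v) (E i))"
    using v c unfolding E_def by (rule mult_left_mono)
  finally have "ennreal (B * \<delta> * b / 4) \<le> ennreal (c * (\<Sum>i\<in>UNIV. measure (P v) (E i)))"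
    by (rule ennreal_leI)
  also have "\<dots> = ennreal c * (\<Sum>i\<in>UNIV. emeasure (P v) (E i))"
    using c by (simp add: ennreal_mult sum_nonneg emeasure_eq_measure)
  also have "\<dots> = (\<integral>\<^sup>+uh. ennreal c * (\<Sum>i\<in>UNIV. indicator (E i) uh) \<partial>P v)"
    using E by (simp add: nn_integral_cmult nn_integral_sum)
  also have "\<dots> \<le> (\<integral>\<^sup>+uh. ennreal (slope B \<delta> v \<bullet> outp (fst uh) (snd uh)
      - Inf ((\<lambda>x. slope B \<delta> v \<bullet> x) ` cube b)) \<partial>P v)"
  proof (rule nn_integral_mono)
    fix uh assume "uh \<in> space (P v)"
    then have uh: "uh \<in> space run_space" using sets_eq_imp_space_eq[OF P(2)] by blast
    let ?x = "outp (fst uh) (snd uh)"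
    have "ennreal c * (\<Sum>i\<in>UNIV. indicator (E i) uh)
      = ennreal (c * (\<Sum>i\<in>UNIV. of_bool (if v i then 0 \<le> ?x $ i else ?x $ i < 0)))"
    proof -
      have "indicator (E i) uh = ennreal (of_bool (if v i then 0 \<le> ?x $ i else ?x $ i < 0))" for i
        using uh by (auto simp: E_def A_def indicator_def not_le)
      then show ?thesis using c by (simp add: ennreal_mult sum_nonneg)
    qed
    also have "\<dots> \<le> ennreal (slope B \<delta> v \<bullet> ?x - Inf ((\<lambda>x. slope B \<delta> v \<bullet> x) ` cube b))"
      unfolding c_def using assms oc by (intro ennreal_leI slope_gap) auto
    finally show "ennreal c * (\<Sum>i\<in>UNIV. indicator (E i) uh)
      \<le> ennreal (slope B \<delta> v \<bullet> ?x - Inf ((\<lambda>x. slope B \<delta> v \<bullet> x) ` cube b))" .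
  qed
  finally show ?thesis unfolding opt_error_def P_def by blast
qed

text \<open>The supremum over function-oracle pairs is innermost, so the bad \<open>v\<close> may
  depend on the algorithm and on the channel strategy.\<close>

lemma minimax_error_cube_ge:
  fixes \<epsilon> \<delta> B b :: real
  assumes p: "2 \<le> p" and "0 \<le> \<epsilon>" and \<delta>: "0 \<le> \<delta>" "\<delta> \<le> 1" and "0 \<le> B" "0 \<le> b"
    and "(1 + (\<delta> / real CARD('n) * ((exp \<epsilon> - 1) * exp \<epsilon>))\<^sup>2) ^ T \<le> 2"
  shows "ennreal (B * \<delta> * b / 4) \<le> minimax_error (cube b :: (real^'n) set) p B T \<epsilon>"
  unfolding minimax_error_def
proof (intro INF_greatest)
  fix alg S
  assume "alg \<in> {(\<mu>, query, outp). algorithm (cube b :: (real^'n) set) \<mu> query outp}"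
    and "S \<in> {S :: nat \<Rightarrow> (nat \<Rightarrow> real^'n) \<Rightarrow> real^'n \<Rightarrow> (real^'n) measure. strategy \<epsilon> S}"
  then have "algorithm (cube b) (fst alg) (fst (snd alg)) (snd (snd alg))" "strategy \<epsilon> S" by auto
  from hard_instance[OF this assms(2-7)] obtain v where
    v: "ennreal (B * \<delta> * b / 4) \<le> opt_error (cube b) (\<lambda>x. slope B \<delta> v \<bullet> x) (\<lambda>_. spike B \<delta> v)
      (fst alg) (fst (snd alg)) (snd (snd alg)) S T" by blast
  show "ennreal (B * \<delta> * b / 4) \<le> (SUP fO \<in> {(f, Orc). oracle_pair p B (cube b) f Orc}.
      opt_error (cube b) (fst fO) (snd fO) (fst alg) (fst (snd alg)) (snd (snd alg)) S T)"
    by (rule SUP_upper2[of "(\<lambda>x. slope B \<delta> v \<bullet> x, \<lambda>_. spike B \<delta> v)"])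
      (use v oracle_pair_spike[OF p \<delta>] in auto)
qed

section \<open>Elementary estimates and the choice of constants\<close>

lemma exp_minus_one_le_linear:
  assumes "0 \<le> x" "x \<le> (1::real)"
  shows "exp x - 1 \<le> (exp 1 - 1) * x"
  using convex_onD[OF exp_convex, of x 0 1] assms by (simp add: algebra_simps)

lemma power_one_plus_le_exp:
  assumes "0 \<le> (x::real)"
  shows "(1 + x) ^ n \<le> exp (real n * x)"
  using power_mono[OF exp_ge_add_one_self, of x n] assms by (simp add: exp_of_nat_mult)

theorem theorem2:
  fixes p :: ereal and \<epsilon> D B :: real and T :: nat
  assumes "2 \<le> p" and "0 \<le> \<epsilon>" and "\<epsilon> \<le> 1" and "D > 0" and "B > 0"
    and "real T \<ge> (1 / (2 * exp 1 * (exp 1 - 1)\<^sup>2)) * (real CARD('n)) ^ 2 / \<epsilon> ^ 2"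
  shows "(SUP X \<in> (Xset p D :: (real^'n) set set). minimax_error X p B T \<epsilon>)
           \<ge> ennreal ((1 / (36 * (exp 1 - 1) * sqrt (2 * exp 1))) * D * B
                * real (CARD('n)) powr (1/2 - inv_exp p) / sqrt (real T)
                * sqrt (real (CARD('n)) / \<epsilon> ^ 2))"
proof (cases "\<epsilon> = 0")
  \<comment> \<open>Division by zero yields 0, so for \<epsilon> = 0 the claimed bound is 0.\<close>
  case True
  then show ?thesis by simp
next
  case False
  then have \<epsilon>: "0 < \<epsilon>" using assms(2) by simp
  define d where "d = real CARD('n)"
  define e1 where "e1 = (exp 1 - 1 :: real)"
  define m where "m = sqrt (2 * exp 1 :: real)"
  define t where "t = sqrt (real T)"
  \<comment> \<open>The bias is chosen so that B \<delta> b / 4 equals the claimed bound: 2/9 times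
    1/2 times 1/4 gives the factor 1/36.\<close>
  define \<delta> where "\<delta> = 2 * d / (9 * e1 * m * (\<epsilon> * t))"
  define b where "b = D / (2 * d powr inv_exp p)"
  have d: "0 < d" by (simp add: d_def)
  have e1: "0 < e1" by (simp add: e1_def)
  have m: "0 < m" "m\<^sup>2 = 2 * exp 1" by (simp_all add: m_def)
  \<comment> \<open>Since (m e1)^2 = 2 e (e - 1)^2 is the reciprocal of the constant in the
    assumption on \<open>T\<close>, that assumption reads d \<le> m e1 \<epsilon> t. It forces T > 0
    and \<delta> \<le> 2/9.\<close>
  have "(d / (m * e1 * \<epsilon>))\<^sup>2 \<le> real T"
    using assms(6) by (simp add: power_mult_distrib power_divide m d_def e1_def)
  then have t1: "d / (m * e1 * \<epsilon>) \<le> t"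
    unfolding t_def by (rule real_le_rsqrt)
  have "0 < d / (m * e1 * \<epsilon>)" using d m e1 \<epsilon> by simp
  then have t: "0 < t" using t1 by linarith
  have t2: "t\<^sup>2 = real T" by (simp add: t_def)
  have dt: "d \<le> m * e1 * (\<epsilon> * t)"
    using t1 m e1 \<epsilon> by (simp add: divide_le_eq mult.commute mult.left_commute)
  have pos: "0 < m * e1 * (\<epsilon> * t)" using m e1 \<epsilon> t by simp
  have \<delta>_eq: "\<delta> = 2 * d / (9 * (m * e1 * (\<epsilon> * t)))" by (simp add: \<delta>_def)
  have \<delta>: "0 \<le> \<delta>" unfolding \<delta>_eq using d pos by (intro divide_nonneg_pos) linarith+
  have \<delta>1: "\<delta> \<le> 1" unfolding \<delta>_eq using d pos dt by (subst divide_le_eq_1_pos) linarith+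
  have "(exp \<epsilon> - 1) * exp \<epsilon> \<le> (e1 * \<epsilon>) * exp 1"
    unfolding e1_def using assms by (intro mult_mono exp_minus_one_le_linear) auto
  then have "\<delta> / d * ((exp \<epsilon> - 1) * exp \<epsilon>) \<le> \<delta> / d * ((e1 * \<epsilon>) * exp 1)"
    using \<delta> d by (intro mult_left_mono) auto
  \<comment> \<open>The factors d, e - 1 and \<epsilon> cancel. As m^2 = 2e, squaring leaves 2e /
    (81 T), so the exponent accumulated over \<open>T\<close> rounds is at most 2e/81, well below ln
    2.\<close>
  also have "\<dots> = 2 * exp 1 / (9 * m * t)" using d e1 \<epsilon> by (simp add: \<delta>_def)
  finally have "(\<delta> / d * ((exp \<epsilon> - 1) * exp \<epsilon>))\<^sup>2 \<le> (2 * exp 1 / (9 * m * t))\<^sup>2"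
    using \<delta> d assms(2) by (intro power_mono) auto
  also have "\<dots> = 2 * exp 1 / 81 / real T"
    unfolding power_divide power_mult_distrib m(2) t2 by (simp add: power2_eq_square)
  finally have "real T * (\<delta> / d * ((exp \<epsilon> - 1) * exp \<epsilon>))\<^sup>2 \<le> 2 * exp 1 / 81"
    using t by (cases "T = 0") (auto simp: t_def field_simps)
  also have "\<dots> \<le> ln 2"
    using exp_le ln2_ge_two_thirds by simp
  finally have "exp (real T * (\<delta> / d * ((exp \<epsilon> - 1) * exp \<epsilon>))\<^sup>2) \<le> 2"
    by (simp add: ln_ge_iff)
  then have small: "(1 + (\<delta> / d * ((exp \<epsilon> - 1) * exp \<epsilon>))\<^sup>2) ^ T \<le> 2"
    using power_one_plus_le_exp[OF zero_le_power2] order_trans by blast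
  \<comment> \<open>The dimension factors of the bound combine to d^(1 - 1/p), which is the d in
    \<delta> divided by the d^(1/p) in \<open>b\<close>.\<close>
  have "d powr (1/2 - inv_exp p) * sqrt d = d / d powr inv_exp p"
    using d by (simp add: powr_diff powr_half_sqrt)
  then have eq: "1 / (36 * e1 * m) * D * B * d powr (1/2 - inv_exp p) / t * sqrt (d / \<epsilon> ^ 2) = B * \<delta> * b / 4"
    using \<epsilon> by (simp add: real_sqrt_divide \<delta>_def b_def field_simps)
  have "ennreal (B * \<delta> * b / 4) \<le> minimax_error (cube b :: (real^'n) set) p B T \<epsilon>"
    using assms \<delta> \<delta>1 small by (intro minimax_error_cube_ge) (auto simp: d_def b_def)
  also have "\<dots> \<le> (SUP X \<in> (Xset p D :: (real^'n) set set). minimax_error X p B T \<epsilon>)"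
    using cube_in_Xset[OF assms(1,4)] unfolding b_def d_def by (rule SUP_upper)
  finally show ?thesis unfolding eq[symmetric] by (simp only: d_def e1_def m_def t_def)
qed

end
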